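(* Let $\Gamma$ be a cofinite graph and let $I$ be the filter base of all compatible cofinite entourages of $\Gamma$. Let $\overline\Gamma$ be the completion of $\Gamma$. Then $\overline\Gamma$ is also a cofinite graph, and $\{\overline R\mid R\in I\}$, where $\overline R$ denotes the closure of $R$ in $\overline\Gamma\times\overline\Gamma$, is the filter base of all compatible cofinite entourages of $\overline\Gamma$.
   Context: A graph is a set $\Gamma$ partitioned into subsets $V(\Gamma)$ (vertices) and $E(\Gamma)$ (edges), with maps $s,t\colon E(\Gamma)\to V(\Gamma)$ and $e\mapsto\overline e$, $E(\Gamma)\to E(\Gamma)$, such that $\overline e\ne e$, $\overline{\overline e}=e$, $t(\overline e)=s(e)$, $s(\overline e)=t(e)$ for all edges $e$. A topological graph is a graph with a topology such that $V(\Gamma),E(\Gamma)$ are closed, $s,t$ and edge inversion are continuous, and which admits an orientation, i.e. a closed subset $E^+(\Gamma)\subseteq E(\Gamma)$ containing exactly one edge of each pair $\{e,\overline e\}$. An equivalence relation $R$ on a graph $\Gamma$ is compatible if: (1) $R=R_V\cup R_E$, where $R_V,R_E$ are equivalence relations on $V(\Gamma),E(\Gamma)$ (the restrictions of $R$); (2) $(e_1,e_2)\in R_E$ implies $(s(e_1),s(e_2)),(t(e_1),t(e_2)),(\overline{e_1},\overline{e_2})\in R$; (3) $(e,\overline e)\notin R$ for all $e\in E(\Gamma)$. A cofinite entourage of a uniform space $X$ is an entourage $R$ that is an equivalence relation on $X$ such that $X/R$ is a finite discrete space. A cofinite graph is an abstract graph $\Gamma$ endowed with a Hausdorff uniformity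 such that every entourage of $\Gamma$ contains a compatible cofinite entourage. A completion of a cofinite graph $\Gamma$ is a compact Hausdorff topological graph $\overline\Gamma$ that contains $\Gamma$ as a dense (uniform) subgraph, i.e. $\Gamma$ is a dense subgraph and the uniformity of $\Gamma$ is the one induced by that of $\overline\Gamma$. A compact Hausdorff space is always endowed with the unique uniformity inducing its topology. *)

theory Defs
  imports "HOL-Analysis.Analysis"
begin

text \<open>
  The vertices and edges of a graph lie in a single type, since the uniformity lives on the
  whole set \<open>V \<union> E\<close>. The values of \<open>src\<close>, \<open>tgt\<close>, \<open>bar\<close> outside \<open>edges\<close> are irrelevant.
\<close>

record 'a graph =
  verts :: "'a set"
  edges :: "'a set"
  src :: "'a \<Rightarrow> 'a"
  tgt :: "'a \<Rightarrow> 'a"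
  bar :: "'a \<Rightarrow> 'a"

definition carr :: "'a graph \<Rightarrow> 'a set" where
  "carr G = verts G \<union> edges G"

definition is_graph :: "'a graph \<Rightarrow> bool" where
  "is_graph G \<longleftrightarrow>
     verts G \<inter> edges G = {} \<and>
     (\<forall>e\<in>edges G. src G e \<in> verts G \<and> tgt G e \<in> verts G \<and> bar G e \<in> edges G \<and>
        bar G e \<noteq> e \<and> bar G (bar G e) = e \<and>
        tgt G (bar G e) = src G e \<and> src G (bar G e) = tgt G e)"

definition subgraph :: "'a graph \<Rightarrow> 'a graph \<Rightarrow> bool" where
  "subgraph G H \<longleftrightarrow>
     is_graph G \<and> is_graph H \<and> verts G \<subseteq> verts H \<and> edges G \<subseteq> edges H \<and>
     (\<forall>e\<in>edges G. src G e = src H e \<and> tgt G e = tgt H e \<and> bar G e = bar H e)"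

definition orientation :: "'a graph \<Rightarrow> 'a set \<Rightarrow> bool" where
  "orientation G P \<longleftrightarrow> P \<subseteq> edges G \<and> (\<forall>e\<in>edges G. e \<in> P \<longleftrightarrow> bar G e \<notin> P)"

definition topological_graph :: "'a graph \<Rightarrow> 'a topology \<Rightarrow> bool" where
  "topological_graph G T \<longleftrightarrow>
     is_graph G \<and> topspace T = carr G \<and>
     closedin T (verts G) \<and> closedin T (edges G) \<and>
     continuous_map (subtopology T (edges G)) (subtopology T (verts G)) (src G) \<and>
     continuous_map (subtopology T (edges G)) (subtopology T (verts G)) (tgt G) \<and>
     continuous_map (subtopology T (edges G)) (subtopology T (edges G)) (bar G) \<and>
     (\<exists>P. closedin T P \<and> orientation G P)"

text \<open>
  The library has uniform spaces only as a type class. The following relativises the axioms of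
  the class \<^class>\<open>uniform_space\<close> to a carrier set \<open>X\<close>, keeping the representation of a
  uniformity as a filter on pairs. Inclusion in \<open>principal (X \<times> X)\<close> says that the
  filter is the one generated by the entourages, which are subsets of \<open>X \<times> X\<close>.
\<close>

definition uniformity_on :: "'a set \<Rightarrow> ('a \<times> 'a) filter \<Rightarrow> bool" where
  "uniformity_on X F \<longleftrightarrow>
     F \<le> principal (X \<times> X) \<and>
     (\<forall>E. eventually E F \<longrightarrow> (\<forall>x\<in>X. E (x, x))) \<and>
     (\<forall>E. eventually E F \<longrightarrow> eventually (\<lambda>(x, y). E (y, x)) F) \<and>
     (\<forall>E. eventually E F \<longrightarrow>
        (\<exists>D. eventually D F \<and> (\<forall>x y z. D (x, y) \<longrightarrow> D (y, z) \<longrightarrow> E (x, z))))"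

definition entourage :: "'a set \<Rightarrow> ('a \<times> 'a) filter \<Rightarrow> ('a \<times> 'a) set \<Rightarrow> bool" where
  "entourage X F R \<longleftrightarrow> R \<subseteq> X \<times> X \<and> eventually (\<lambda>p. p \<in> R) F"

definition unif_topology :: "'a set \<Rightarrow> ('a \<times> 'a) filter \<Rightarrow> 'a topology" where
  "unif_topology X F =
     topology (\<lambda>U. U \<subseteq> X \<and> (\<forall>x\<in>U. eventually (\<lambda>(x', y). x' = x \<longrightarrow> y \<in> U) F))"

lemma openin_unif_topology:
  "openin (unif_topology X F) U \<longleftrightarrow>
     U \<subseteq> X \<and> (\<forall>x\<in>U. eventually (\<lambda>(x', y). x' = x \<longrightarrow> y \<in> U) F)"
proof -
  have "istopology (\<lambda>U. U \<subseteq> X \<and> (\<forall>x\<in>U. eventually (\<lambda>(x', y). x' = x \<longrightarrow> y \<in> U) F))"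
    unfolding istopology_def
  proof (intro conjI allI impI ballI)
    fix S T x
    assume S: "S \<subseteq> X \<and> (\<forall>x\<in>S. eventually (\<lambda>(x', y). x' = x \<longrightarrow> y \<in> S) F)"
      and T: "T \<subseteq> X \<and> (\<forall>x\<in>T. eventually (\<lambda>(x', y). x' = x \<longrightarrow> y \<in> T) F)"
    show "S \<inter> T \<subseteq> X" using S by blast
    assume "x \<in> S \<inter> T"
    then have "eventually (\<lambda>(x', y). x' = x \<longrightarrow> y \<in> S) F" "eventually (\<lambda>(x', y). x' = x \<longrightarrow> y \<in> T) F"
      using S T by auto
    then show "eventually (\<lambda>(x', y). x' = x \<longrightarrow> y \<in> S \<inter> T) F"
      by eventually_elim auto
  next
    fix K x
    assume K: "\<forall>S\<in>K. S \<subseteq> X \<and> (\<forall>x\<in>S. eventually (\<lambda>(x', y). x' = x \<longrightarrow> y \<in> S) F)"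
    show "\<Union>K \<subseteq> X" using K by blast
    assume "x \<in> \<Union>K"
    then obtain S where S: "S \<in> K" "x \<in> S" by blast
    with K have "eventually (\<lambda>(x', y). x' = x \<longrightarrow> y \<in> S) F" by blast
    then show "eventually (\<lambda>(x', y). x' = x \<longrightarrow> y \<in> \<Union>K) F"
      by eventually_elim (use S in auto)
  qed
  then show ?thesis by (simp add: unif_topology_def topology_inverse')
qed

lemma topspace_unif_topology:
  assumes "uniformity_on X F"
  shows "topspace (unif_topology X F) = X"
proof -
  have "eventually (\<lambda>p. p \<in> X \<times> X) F"
    using assms by (simp add: uniformity_on_def le_principal)
  then have "eventually (\<lambda>(x', y). x' = x \<longrightarrow> y \<in> X) F" for x
    by eventually_elim auto
  then have "openin (unif_topology X F) X"
    by (simp add: openin_unif_topology)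
  then show ?thesis
    by (metis openin_subset openin_topspace openin_unif_topology subset_antisym)
qed

lemma uniformity_on_UNIV: "uniformity_on UNIV (uniformity :: ('a::uniform_space \<times> 'a) filter)"
  unfolding uniformity_on_def
  by (intro conjI allI impI ballI uniformity_sym uniformity_trans) (auto dest: uniformity_refl)

lemma unif_topology_UNIV:
  "unif_topology UNIV (uniformity :: ('a::uniform_space \<times> 'a) filter) = euclidean"
  by (simp add: topology_eq openin_unif_topology open_uniformity)

definition induced_uniformity :: "('a \<times> 'a) filter \<Rightarrow> 'a set \<Rightarrow> ('a \<times> 'a) filter" where
  "induced_uniformity F Y = inf F (principal (Y \<times> Y))"

definition compatible :: "'a graph \<Rightarrow> ('a \<times> 'a) set \<Rightarrow> bool" where
  "compatible G R \<longleftrightarrow>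
     equiv (carr G) R \<and>
     (let RV = R \<inter> verts G \<times> verts G; RE = R \<inter> edges G \<times> edges G in
       R = RV \<union> RE \<and> equiv (verts G) RV \<and> equiv (edges G) RE \<and>
       (\<forall>(e1, e2)\<in>RE. (src G e1, src G e2) \<in> R \<and> (tgt G e1, tgt G e2) \<in> R \<and>
          (bar G e1, bar G e2) \<in> R)) \<and>
     (\<forall>e\<in>edges G. (e, bar G e) \<notin> R)"

text \<open>The last conjunct says that the quotient topology on \<open>X // R\<close> is discrete.\<close>

definition cofinite_entourage :: "'a set \<Rightarrow> ('a \<times> 'a) filter \<Rightarrow> ('a \<times> 'a) set \<Rightarrow> bool" where
  "cofinite_entourage X F R \<longleftrightarrow>
     entourage X F R \<and> equiv X R \<and> finite (X // R) \<and>
     quotient_map (unif_topology X F) (discrete_topology (X // R)) (\<lambda>x. R `` {x})"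

definition compatible_cofinite_entourages ::
    "'a graph \<Rightarrow> ('a \<times> 'a) filter \<Rightarrow> ('a \<times> 'a) set set" where
  "compatible_cofinite_entourages G F = {R. compatible G R \<and> cofinite_entourage (carr G) F R}"

definition cofinite_graph :: "'a graph \<Rightarrow> ('a \<times> 'a) filter \<Rightarrow> bool" where
  "cofinite_graph G F \<longleftrightarrow>
     is_graph G \<and> uniformity_on (carr G) F \<and> Hausdorff_space (unif_topology (carr G) F) \<and>
     (\<forall>S. entourage (carr G) F S \<longrightarrow> (\<exists>R\<in>compatible_cofinite_entourages G F. R \<subseteq> S))"

text \<open>
  The compact Hausdorff topology \<open>T\<close> determines the uniformity \<open>F'\<close> on \<open>H\<close> uniquely; it is
  kept as an explicit argument.
\<close>

definition is_completion ::
    "'a graph \<Rightarrow> ('a \<times> 'a) filter \<Rightarrow> 'a graph \<Rightarrow> 'a topology \<Rightarrow> ('a \<times> 'a) filter \<Rightarrow> bool" where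
  "is_completion G F H T F' \<longleftrightarrow>
     topological_graph H T \<and> compact_space T \<and> Hausdorff_space T \<and>
     uniformity_on (carr H) F' \<and> unif_topology (carr H) F' = T \<and>
     subgraph G H \<and> T closure_of (carr G) = carr H \<and>
     F = induced_uniformity F' (carr G)"

text \<open>
  A base of the filter \<open>F\<close>. The customary condition \<open>{} \<notin> B\<close> is omitted because
  the uniformity of the empty graph is the improper filter; for a nonempty
  carrier it follows from reflexivity of the entourages.
\<close>

definition filter_base_of :: "'b set set \<Rightarrow> 'b filter \<Rightarrow> bool" where
  "filter_base_of B F \<longleftrightarrow>
     B \<noteq> {} \<and> (\<forall>R\<in>B. \<forall>S\<in>B. \<exists>Q\<in>B. Q \<subseteq> R \<inter> S) \<and>
     (\<forall>P. eventually P F \<longleftrightarrow> (\<exists>R\<in>B. \<forall>p\<in>R. P p))"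

end

theory Submission
  imports Defs
begin

text \<open>
  Write \<open>X\<close> for the carrier of \<open>G\<close>, a dense subset of the carrier \<open>Y\<close> of \<open>H\<close>. The theorem says that
  closing in \<open>Y \<times> Y\<close> and intersecting with \<open>X \<times> X\<close> are mutually inverse bijections between the
  compatible cofinite entourages of \<open>G\<close> and of \<open>H\<close>, and that the closures are arbitrarily small.

  The uniform part rests on one description of the closure: a pair belongs to the closure of \<open>R\<close>
  iff elements of \<open>R\<close> approximate it to within every entourage (\<open>in_closure_prod_iff\<close>). If \<open>R\<close> is an
  equivalence relation that is an entourage of \<open>X\<close>, two points of \<open>X\<close> that approximate the same point
  of \<open>Y\<close> closely enough are \<open>R\<close>-related. Hence the closure of \<open>R\<close> is transitive and traces \<open>R\<close> on \<open>X\<close>;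
  it is an entourage because \<open>X\<close> is dense; and each of its classes meets \<open>X\<close>, so there are no more of
  them than classes of \<open>R\<close>. Conversely, an equivalence relation that is an entourage of \<open>Y\<close> is the
  closure of its trace. Finally, if \<open>D \<circ> D \<circ> D \<subseteq> E\<close> with \<open>D\<close> a symmetric entourage, then a
  relation contained in \<open>D\<close> has its closure inside \<open>E\<close>, which gives the base property.

  For the graph part, the conditions on \<open>src\<close>, \<open>tgt\<close> and \<open>bar\<close> pass to the closure because they
  describe a closed set of pairs. The condition that no edge is related to its inverse is not a
  closed one; it passes to the closure because every edge of \<open>H\<close> is related to an edge of \<open>G\<close>, where
  the closure agrees with \<open>R\<close>.
\<close>

section \<open>Uniformities on a carrier set\<close>

lemma uniformity_on_carrier:
  assumes "uniformity_on X F"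
  shows "eventually (\<lambda>p. p \<in> X \<times> X) F"
  using assms by (simp add: uniformity_on_def le_principal)

lemma uniformity_on_refl:
  assumes "uniformity_on X F" "eventually E F" "x \<in> X"
  shows "E (x, x)"
  using assms unfolding uniformity_on_def by blast

lemma uniformity_on_third:
  assumes u: "uniformity_on X F" and E: "eventually E F"
  obtains D where "eventually D F" "\<And>x y. D (x, y) \<Longrightarrow> D (y, x)"
    "\<And>x y. D (x, y) \<Longrightarrow> x \<in> X \<and> y \<in> X"
    "\<And>x y z w. \<lbrakk>D (x, y); D (y, z); D (z, w)\<rbrakk> \<Longrightarrow> E (x, w)"
proof -
  have half: "\<exists>D. eventually D F \<and> (\<forall>x y z. D (x, y) \<longrightarrow> D (y, z) \<longrightarrow> E (x, z))"
    if "eventually E F" for E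
    using u that by (simp add: uniformity_on_def)
  obtain D1 where D1: "eventually D1 F" "\<And>x y z. D1 (x, y) \<Longrightarrow> D1 (y, z) \<Longrightarrow> E (x, z)"
    using half[OF E] by blast
  obtain D2 where D2: "eventually D2 F" "\<And>x y z. D2 (x, y) \<Longrightarrow> D2 (y, z) \<Longrightarrow> D1 (x, z)"
    using half[OF D1(1)] by blast
  have refl: "D2 (x, x)" if "x \<in> X" for x
    using uniformity_on_refl[OF u D2(1) that] .
  have "eventually (\<lambda>(x, y). D2 (y, x)) F"
    using u D2(1) by (simp add: uniformity_on_def)
  then have "eventually (\<lambda>(x, y). D2 (x, y) \<and> D2 (y, x) \<and> x \<in> X \<and> y \<in> X) F"
    using D2(1) uniformity_on_carrier[OF u] by eventually_elim auto
  then show thesis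
    by (rule that) (use D1(2) D2(2) refl in \<open>auto, blast\<close>)
qed

text \<open>
  The open set is the set of points that have \<open>{z. D (x, z)}\<close> as a neighbourhood; it is open by
  the triangle axiom.
\<close>

lemma open_set_in_uniform_ball:
  assumes u: "uniformity_on X F" and D: "eventually D F" and x: "x \<in> X"
  obtains U where "openin (unif_topology X F) U" "x \<in> U" "\<And>z. z \<in> U \<Longrightarrow> D (x, z)"
proof -
  define U where "U = {z\<in>X. eventually (\<lambda>(z', w). z' = z \<longrightarrow> D (x, w)) F}"
  have "openin (unif_topology X F) U"
    unfolding openin_unif_topology
  proof (intro conjI ballI)
    show "U \<subseteq> X" by (auto simp: U_def)
    fix z assume "z \<in> U"
    then have "eventually (\<lambda>(z', w). z' = z \<longrightarrow> D (x, w)) F" by (simp add: U_def)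
    then obtain Q where Q: "eventually Q F"
      "\<And>a b c. Q (a, b) \<Longrightarrow> Q (b, c) \<Longrightarrow> a = z \<longrightarrow> D (x, c)"
      using u unfolding uniformity_on_def by fast
    have U: "w \<in> U" if "Q (z, w)" "w \<in> X" for w
    proof -
      have "eventually (\<lambda>(z', v). z' = w \<longrightarrow> D (x, v)) F"
        using Q(1) by eventually_elim (use Q(2) that(1) in auto)
      then show ?thesis using that(2) by (simp add: U_def)
    qed
    from Q(1) uniformity_on_carrier[OF u]
    show "eventually (\<lambda>(x', y). x' = z \<longrightarrow> y \<in> U) F"
      by eventually_elim (use U in auto)
  qed
  moreover have "x \<in> U"
  proof -
    have "eventually (\<lambda>(x', w). x' = x \<longrightarrow> D (x, w)) F"
      using D by eventually_elim auto
    then show ?thesis using x by (simp add: U_def)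
  qed
  moreover have "D (x, z)" if "z \<in> U" for z
  proof -
    have "eventually (\<lambda>(z', w). z' = z \<longrightarrow> D (x, w)) F" "z \<in> X"
      using that by (auto simp: U_def)
    then have "(\<lambda>(z', w). z' = z \<longrightarrow> D (x, w)) (z, z)"
      using uniformity_on_refl[OF u] by blast
    then show ?thesis by simp
  qed
  ultimately show thesis by (rule that)
qed

lemma open_uniform_ball:
  assumes "openin (unif_topology X F) U" "x \<in> U"
  shows "eventually (\<lambda>(x', y). x' = x \<longrightarrow> y \<in> U) F"
  using assms by (simp add: openin_unif_topology)

lemma dense_approx:
  assumes u: "uniformity_on Y F" and dense: "unif_topology Y F closure_of X = Y"
    and D: "eventually D F" and y: "y \<in> Y"
  obtains a where "a \<in> X" "D (y, a)"
proof -
  obtain U where "openin (unif_topology Y F) U" "y \<in> U" "\<And>z. z \<in> U \<Longrightarrow> D (y, z)"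
    using open_set_in_uniform_ball[OF u D y] by metis
  moreover have "y \<in> unif_topology Y F closure_of X" using dense y by simp
  ultimately show thesis using that by (meson in_closure_of)
qed

lemma in_closure_prod_iff:
  assumes u: "uniformity_on Y F"
  shows "(y, y') \<in> prod_topology (unif_topology Y F) (unif_topology Y F) closure_of R \<longleftrightarrow>
    y \<in> Y \<and> y' \<in> Y \<and> (\<forall>D. eventually D F \<longrightarrow> (\<exists>(a, b)\<in>R. D (y, a) \<and> D (y', b)))"
    (is "_ \<in> ?T closure_of R \<longleftrightarrow> ?rhs")
proof
  assume cl: "(y, y') \<in> ?T closure_of R"
  then have Y: "y \<in> Y" "y' \<in> Y"
    by (auto simp: in_closure_of topspace_unif_topology[OF u])
  have "\<exists>(a, b)\<in>R. D (y, a) \<and> D (y', b)" if D: "eventually D F" for D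
  proof -
    obtain U where U: "openin (unif_topology Y F) U" "y \<in> U" "\<And>z. z \<in> U \<Longrightarrow> D (y, z)"
      using open_set_in_uniform_ball[OF u D Y(1)] by metis
    obtain V where V: "openin (unif_topology Y F) V" "y' \<in> V" "\<And>z. z \<in> V \<Longrightarrow> D (y', z)"
      using open_set_in_uniform_ball[OF u D Y(2)] by metis
    have "openin ?T (U \<times> V)" "(y, y') \<in> U \<times> V"
      using U V by (auto simp: openin_prod_Times_iff)
    then obtain p where "p \<in> R" "p \<in> U \<times> V" using cl by (meson in_closure_of)
    then show ?thesis using U(3) V(3) by auto
  qed
  with Y show ?rhs by blast
next
  assume rhs: ?rhs
  have meets: "\<exists>p\<in>R. p \<in> W" if W: "openin ?T W" "(y, y') \<in> W" for W
  proof -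
    obtain U V where UV: "openin (unif_topology Y F) U" "openin (unif_topology Y F) V"
      "y \<in> U" "y' \<in> V" "U \<times> V \<subseteq> W"
      using W unfolding openin_prod_topology_alt by meson
    have "eventually (\<lambda>p. (\<lambda>(x', z). x' = y \<longrightarrow> z \<in> U) p \<and> (\<lambda>(x', z). x' = y' \<longrightarrow> z \<in> V) p) F"
      using open_uniform_ball[OF UV(1,3)] open_uniform_ball[OF UV(2,4)]
      by (rule eventually_conj)
    then obtain a b where "(a, b) \<in> R" "a \<in> U" "b \<in> V" using rhs by fastforce
    then show ?thesis using UV(5) by blast
  qed
  have "(y, y') \<in> topspace ?T" using rhs by (simp add: topspace_unif_topology[OF u])
  then show "(y, y') \<in> ?T closure_of R"
    using meets by (meson in_closure_of)
qed

section \<open>Closing entourages of a dense subspace\<close>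

lemma eventually_induced_uniformity:
  "eventually P (induced_uniformity F X) \<longleftrightarrow> eventually (\<lambda>p. p \<in> X \<times> X \<longrightarrow> P p) F"
  by (simp add: induced_uniformity_def eventually_inf_principal)

text \<open>
  With \<open>D \<circ> D \<circ> D\<close> inside an entourage of \<open>Y\<close> that induces \<open>R\<close>, already \<open>D\<close> lies in the closure: points
  \<open>a\<close>, \<open>b\<close> of \<open>X\<close> near \<open>y\<close>, \<open>y'\<close> are joined by the chain \<open>a\<close>, \<open>y\<close>, \<open>y'\<close>, \<open>b\<close> of three steps in \<open>D\<close>.
\<close>

lemma closure_is_entourage:
  assumes u: "uniformity_on Y F" and dense: "unif_topology Y F closure_of X = Y"
    and R: "entourage X (induced_uniformity F X) R"
  shows "entourage Y F (prod_topology (unif_topology Y F) (unif_topology Y F) closure_of R)"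
    (is "entourage Y F ?cl")
proof -
  have "eventually (\<lambda>p. p \<in> X \<times> X \<longrightarrow> p \<in> R) F"
    using R by (simp add: entourage_def eventually_induced_uniformity)
  then obtain D where D: "eventually D F" "\<And>x y. D (x, y) \<Longrightarrow> D (y, x)"
    "\<And>x y. D (x, y) \<Longrightarrow> x \<in> Y \<and> y \<in> Y"
    "\<And>x y z w. \<lbrakk>D (x, y); D (y, z); D (z, w)\<rbrakk> \<Longrightarrow> (x, w) \<in> X \<times> X \<longrightarrow> (x, w) \<in> R"
    by (rule uniformity_on_third[OF u]) blast
  have "(y, y') \<in> ?cl" if yy: "D (y, y')" for y y'
    unfolding in_closure_prod_iff[OF u]
  proof (intro conjI allI impI)
    show Y: "y \<in> Y" "y' \<in> Y" using D(3)[OF yy] by auto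
    fix E assume "eventually E F"
    then have ED: "eventually (\<lambda>p. E p \<and> D p) F" using D(1) by (rule eventually_conj)
    obtain a where a: "a \<in> X" "E (y, a) \<and> D (y, a)" using dense_approx[OF u dense ED Y(1)] .
    obtain b where b: "b \<in> X" "E (y', b) \<and> D (y', b)" using dense_approx[OF u dense ED Y(2)] .
    have "(a, b) \<in> R" using D(4)[of a y y' b] D(2) a b yy by blast
    then show "\<exists>(a, b)\<in>R. E (y, a) \<and> E (y', b)" using a b by blast
  qed
  then have "eventually (\<lambda>p. p \<in> ?cl) F"
    using D(1) by (auto elim!: eventually_mono)
  moreover have "?cl \<subseteq> Y \<times> Y"
    by (auto simp: in_closure_prod_iff[OF u])
  ultimately show ?thesis by (simp add: entourage_def)
qed

lemma closure_trace:
  assumes u: "uniformity_on Y F" and XY: "X \<subseteq> Y"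
    and R: "entourage X (induced_uniformity F X) R" and eq: "equiv X R"
  shows "prod_topology (unif_topology Y F) (unif_topology Y F) closure_of R \<inter> X \<times> X = R"
    (is "?cl \<inter> _ = _")
proof
  have RX: "R \<subseteq> X \<times> X" using R by (simp add: entourage_def)
  have E: "eventually (\<lambda>p. p \<in> X \<times> X \<longrightarrow> p \<in> R) F"
    using R by (simp add: entourage_def eventually_induced_uniformity)
  show "?cl \<inter> X \<times> X \<subseteq> R"
  proof clarify
    fix x y assume "(x, y) \<in> ?cl" and xy: "x \<in> X" "y \<in> X"
    then have "\<exists>(a, b)\<in>R. ((x, a) \<in> X \<times> X \<longrightarrow> (x, a) \<in> R) \<and> ((y, b) \<in> X \<times> X \<longrightarrow> (y, b) \<in> R)"
      using E unfolding in_closure_prod_iff[OF u] by blast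
    then obtain a b where "(a, b) \<in> R" "(x, a) \<in> R" "(y, b) \<in> R" using RX xy by blast
    then show "(x, y) \<in> R" using eq by (meson equiv_def symD transD)
  qed
  have "R \<subseteq> topspace (prod_topology (unif_topology Y F) (unif_topology Y F))"
    using RX XY by (auto simp: topspace_unif_topology[OF u])
  then show "R \<subseteq> ?cl \<inter> X \<times> X" using closure_of_subset RX by blast
qed

text \<open>
  For transitivity, the middle point \<open>y\<close> of a chain is approximated by two different points \<open>b\<close> and
  \<open>b'\<close> of \<open>X\<close>; these are both close to \<open>y\<close>, hence \<open>R\<close>-related to each other.
\<close>

lemma closure_equiv:
  assumes u: "uniformity_on Y F" and dense: "unif_topology Y F closure_of X = Y"
    and R: "entourage X (induced_uniformity F X) R" and eq: "equiv X R"
  shows "equiv Y (prod_topology (unif_topology Y F) (unif_topology Y F) closure_of R)"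
    (is "equiv Y ?cl")
proof (rule equivI)
  have ent: "entourage Y F ?cl" using closure_is_entourage[OF u dense R] .
  show "?cl \<subseteq> Y \<times> Y" using ent by (simp add: entourage_def)
  show "refl_on Y ?cl"
    using ent uniformity_on_refl[OF u] by (auto simp: refl_on_def entourage_def)
  show "sym ?cl"
  proof (rule symI)
    fix y y' assume "(y, y') \<in> ?cl"
    moreover have "(b, a) \<in> R" if "(a, b) \<in> R" for a b using eq that by (meson equiv_def symD)
    ultimately show "(y', y) \<in> ?cl" unfolding in_closure_prod_iff[OF u] by fast
  qed
  show "trans ?cl"
  proof (rule transI)
    fix x y z assume xy: "(x, y) \<in> ?cl" and yz: "(y, z) \<in> ?cl"
    have RX: "R \<subseteq> X \<times> X" using R by (simp add: entourage_def)
    have "eventually (\<lambda>p. p \<in> X \<times> X \<longrightarrow> p \<in> R) F"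
      using R by (simp add: entourage_def eventually_induced_uniformity)
    then obtain D where D: "eventually D F" "\<And>x y. D (x, y) \<Longrightarrow> D (y, x)"
      "\<And>x y. D (x, y) \<Longrightarrow> x \<in> Y \<and> y \<in> Y"
      "\<And>x y z w. \<lbrakk>D (x, y); D (y, z); D (z, w)\<rbrakk> \<Longrightarrow> (x, w) \<in> X \<times> X \<longrightarrow> (x, w) \<in> R"
      by (rule uniformity_on_third[OF u]) blast
    have refl: "D (w, w)" if "w \<in> Y" for w
      using uniformity_on_refl[OF u D(1) that] .
    show "(x, z) \<in> ?cl"
      unfolding in_closure_prod_iff[OF u]
    proof (intro conjI allI impI)
      show "x \<in> Y" "z \<in> Y" using xy yz by (auto simp: in_closure_prod_iff[OF u])
      fix E assume "eventually E F"
      then have ED: "eventually (\<lambda>p. E p \<and> D p) F" using D(1) by (rule eventually_conj)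
      obtain a b where ab: "(a, b) \<in> R" "E (x, a)" "D (y, b)"
        using xy ED unfolding in_closure_prod_iff[OF u] by blast
      obtain b' c where bc: "(b', c) \<in> R" "E (z, c)" "D (y, b')"
        using yz ED unfolding in_closure_prod_iff[OF u] by blast
      have "D (b, y)" "D (b', b')" using D(2,3) refl ab(3) bc(3) by blast+
      then have "(b, b') \<in> R" using D(4)[of b y b' b'] ab(1) bc(1,3) RX by blast
      then have "(a, c) \<in> R" using ab(1) bc(1) eq by (meson equiv_def transD)
      then show "\<exists>(a, c)\<in>R. E (x, a) \<and> E (z, c)" using ab(2) bc(2) by blast
    qed
  qed
qed

text \<open>
  Each class of the closure meets \<open>X\<close> because it is a neighbourhood of its points, and it is then
  the saturation of any class of \<open>R\<close> that it meets.
\<close>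

lemma closure_finite_quotient:
  assumes u: "uniformity_on Y F" and XY: "X \<subseteq> Y"
    and dense: "unif_topology Y F closure_of X = Y"
    and R: "entourage X (induced_uniformity F X) R" and eq: "equiv X R"
    and fin: "finite (X // R)"
  shows "finite (Y // (prod_topology (unif_topology Y F) (unif_topology Y F) closure_of R))"
    (is "finite (Y // ?cl)")
proof -
  have ent: "entourage Y F ?cl" using closure_is_entourage[OF u dense R] .
  have eq': "equiv Y ?cl" using closure_equiv[OF u dense R eq] .
  have R_cl: "R \<subseteq> ?cl" using closure_trace[OF u XY R eq] by blast
  have "Y // ?cl \<subseteq> (\<lambda>C. ?cl `` C) ` (X // R)"
  proof
    fix K assume "K \<in> Y // ?cl"
    then obtain y where y: "y \<in> Y" "K = ?cl `` {y}" by (auto elim: quotientE)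
    have "eventually (\<lambda>p. p \<in> ?cl) F" using ent by (simp add: entourage_def)
    then obtain x where x: "x \<in> X" "(y, x) \<in> ?cl" using dense_approx[OF u dense _ y(1)] by blast
    have K: "K = ?cl `` {x}" using y(2) x(2) eq' by (simp add: equiv_class_eq)
    have "x \<in> R `` {x}" using equiv_class_self[OF eq x(1)] .
    moreover have "?cl `` {w} = ?cl `` {x}" if "w \<in> R `` {x}" for w
      using equiv_class_eq[OF eq', of x w] R_cl that by auto
    ultimately have "?cl `` (R `` {x}) = ?cl `` {x}" by blast
    with K have "K = (\<lambda>C. ?cl `` C) (R `` {x})" by simp
    then show "K \<in> (\<lambda>C. ?cl `` C) ` (X // R)" using quotientI[OF x(1)] by (rule image_eqI)
  qed
  with fin show ?thesis by (meson finite_imageI finite_subset)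
qed

text \<open>
  Both inclusions use \<open>S\<close> itself as a measure of closeness: approximating points in the sense of
  \<open>S\<close> lie in the same class as the points that they approximate.
\<close>

lemma closure_of_trace:
  assumes u: "uniformity_on Y F" and dense: "unif_topology Y F closure_of X = Y"
    and S: "entourage Y F S" and eq: "equiv Y S"
  shows "prod_topology (unif_topology Y F) (unif_topology Y F) closure_of (S \<inter> X \<times> X) = S"
    (is "?cl = S")
proof (rule set_eqI, clarify)
  fix y y'
  have evS: "eventually (\<lambda>p. p \<in> S) F" and SY: "S \<subseteq> Y \<times> Y" using S by (auto simp: entourage_def)
  have rel: "(a, d) \<in> S" if "(b, a) \<in> S" "(b, c) \<in> S" "(c, d) \<in> S" for a b c d
    using eq that by (meson equiv_def symD transD)
  have sym: "(b, a) \<in> S" if "(a, b) \<in> S" for a b using eq that by (meson equiv_def symD)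
  show "(y, y') \<in> ?cl \<longleftrightarrow> (y, y') \<in> S"
  proof
    assume "(y, y') \<in> ?cl"
    then obtain a b where "(a, b) \<in> S" "(y, a) \<in> S" "(y', b) \<in> S"
      using evS unfolding in_closure_prod_iff[OF u] by blast
    then show "(y, y') \<in> S" using rel sym by blast
  next
    assume yy: "(y, y') \<in> S"
    then have Y: "y \<in> Y" "y' \<in> Y" using SY by auto
    have "\<exists>(a, b)\<in>S \<inter> X \<times> X. E (y, a) \<and> E (y', b)" if "eventually E F" for E
    proof -
      have ES: "eventually (\<lambda>p. E p \<and> p \<in> S) F" using that evS by (rule eventually_conj)
      obtain a where a: "a \<in> X" "E (y, a) \<and> (y, a) \<in> S" using dense_approx[OF u dense ES Y(1)] .
      obtain b where b: "b \<in> X" "E (y', b) \<and> (y', b) \<in> S" using dense_approx[OF u dense ES Y(2)] .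
      have "(a, b) \<in> S" using rel a b yy by blast
      with a b show ?thesis by blast
    qed
    with Y show "(y, y') \<in> ?cl" unfolding in_closure_prod_iff[OF u] by blast
  qed
qed

text \<open>
  This makes the closures a base: a bound \<open>D\<close> on a relation in \<open>X \<times> X\<close> yields a prescribed bound
  \<open>E\<close> on its closure.
\<close>

lemma small_closure:
  assumes u: "uniformity_on Y F" and E: "eventually E F"
  obtains D where "eventually D F"
    "\<And>R. (\<And>p. p \<in> R \<Longrightarrow> D p) \<Longrightarrow>
       \<forall>p\<in>prod_topology (unif_topology Y F) (unif_topology Y F) closure_of R. E p"
proof -
  obtain D where D: "eventually D F" "\<And>x y. D (x, y) \<Longrightarrow> D (y, x)"
    "\<And>x y z w. \<lbrakk>D (x, y); D (y, z); D (z, w)\<rbrakk> \<Longrightarrow> E (x, w)"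
    by (rule uniformity_on_third[OF u E]) blast
  have "E (y, y')" if RD: "\<And>p. p \<in> R \<Longrightarrow> D p"
    and cl: "(y, y') \<in> prod_topology (unif_topology Y F) (unif_topology Y F) closure_of R" for R y y'
  proof -
    obtain a b where ab: "(a, b) \<in> R" "D (y, a)" "D (y', b)"
      using cl D(1) unfolding in_closure_prod_iff[OF u] by blast
    have "D (b, y')" using D(2)[OF ab(3)] .
    then show ?thesis using D(3)[OF ab(2) RD[OF ab(1)]] by blast
  qed
  then show thesis using that[OF D(1)] by force
qed

section \<open>Cofinite and compatible entourages\<close>

text \<open>
  The classes of an equivalence relation that is an entourage are open, so the quotient topology
  is automatically discrete.
\<close>

lemma cofinite_entourage_iff:
  assumes u: "uniformity_on X F"
  shows "cofinite_entourage X F R \<longleftrightarrow> entourage X F R \<and> equiv X R \<and> finite (X // R)"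
proof -
  have "quotient_map (unif_topology X F) (discrete_topology (X // R)) (\<lambda>x. R `` {x})"
    if ent: "entourage X F R" and eq: "equiv X R"
  proof -
    have "openin (unif_topology X F) {x \<in> X. R `` {x} \<in> U}" for U
      unfolding openin_unif_topology
    proof (intro conjI ballI)
      fix x assume x: "x \<in> {x \<in> X. R `` {x} \<in> U}"
      have "eventually (\<lambda>p. p \<in> R) F" using ent by (simp add: entourage_def)
      with uniformity_on_carrier[OF u]
      show "eventually (\<lambda>(x', y). x' = x \<longrightarrow> y \<in> {x \<in> X. R `` {x} \<in> U}) F"
        by eventually_elim (use x equiv_class_eq[OF eq] in auto)
    qed auto
    then show ?thesis
      by (auto simp: quotient_map_def topspace_unif_topology[OF u] quotient_def)
  qed
  then show ?thesis unfolding cofinite_entourage_def by blast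
qed

text \<open>
  A single inclusion of \<open>R\<close> in a set of pairs replaces the splitting of \<open>R\<close> and the incidence
  conditions, so that a closure argument can be applied to it.
\<close>

lemma compatible_iff:
  assumes "is_graph G"
  shows "compatible G R \<longleftrightarrow> equiv (carr G) R \<and>
     R \<subseteq> verts G \<times> verts G \<union> {(a, b) \<in> edges G \<times> edges G.
       (src G a, src G b) \<in> R \<and> (tgt G a, tgt G b) \<in> R \<and> (bar G a, bar G b) \<in> R} \<and>
     (\<forall>e\<in>edges G. (e, bar G e) \<notin> R)"
proof -
  let ?V = "verts G" and ?E = "edges G"
  let ?Q = "\<lambda>a b. (src G a, src G b) \<in> R \<and> (tgt G a, tgt G b) \<in> R \<and> (bar G a, bar G b) \<in> R"
  have disj: "?V \<inter> ?E = {}" using assms by (simp add: is_graph_def)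
  have restr: "equiv A (R \<inter> A \<times> A)" if "equiv (carr G) R" "A \<subseteq> carr G" for A
    using that unfolding equiv_def refl_on_def sym_def trans_def by blast
  have equivs: "equiv ?V (R \<inter> ?V \<times> ?V)" "equiv ?E (R \<inter> ?E \<times> ?E)" if "equiv (carr G) R"
    using restr[OF that] by (auto simp: carr_def)
  have absorb: "R = R \<inter> W \<longleftrightarrow> R \<subseteq> W" for W by auto
  have split: "R = R \<inter> ?V \<times> ?V \<union> R \<inter> ?E \<times> ?E \<longleftrightarrow>
      (\<forall>a b. (a, b) \<in> R \<longrightarrow> a \<in> ?V \<and> b \<in> ?V \<or> a \<in> ?E \<and> b \<in> ?E)"
    unfolding Int_Un_distrib[symmetric] absorb by auto
  have ops: "(\<forall>(a, b)\<in>R \<inter> ?E \<times> ?E. ?Q a b) \<longleftrightarrow> (\<forall>a b. (a, b) \<in> R \<longrightarrow> a \<in> ?E \<longrightarrow> b \<in> ?E \<longrightarrow> ?Q a b)"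
    by auto
  have sub: "R \<subseteq> ?V \<times> ?V \<union> {(a, b) \<in> ?E \<times> ?E. ?Q a b} \<longleftrightarrow>
      (\<forall>a b. (a, b) \<in> R \<longrightarrow> a \<in> ?V \<and> b \<in> ?V \<or> a \<in> ?E \<and> b \<in> ?E \<and> ?Q a b)"
    by auto
  have "R = R \<inter> ?V \<times> ?V \<union> R \<inter> ?E \<times> ?E \<and> (\<forall>(a, b)\<in>R \<inter> ?E \<times> ?E. ?Q a b) \<longleftrightarrow>
      R \<subseteq> ?V \<times> ?V \<union> {(a, b) \<in> ?E \<times> ?E. ?Q a b}"
    unfolding split ops sub using disj by blast
  then show ?thesis
    unfolding compatible_def Let_def using equivs by argo
qed

lemma trace_compatible:
  assumes sub: "subgraph G H" and S: "compatible H S"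
  shows "compatible G (S \<inter> carr G \<times> carr G)"
proof -
  have G: "is_graph G" and H: "is_graph H" using sub by (auto simp: subgraph_def)
  have le: "verts G \<subseteq> verts H" "edges G \<subseteq> edges H"
    and ops: "\<And>e. e \<in> edges G \<Longrightarrow> src H e = src G e \<and> tgt H e = tgt G e \<and> bar H e = bar G e"
    using sub by (auto simp: subgraph_def)
  have closed: "src G e \<in> carr G \<and> tgt G e \<in> carr G \<and> bar G e \<in> carr G" if "e \<in> edges G" for e
    using G that by (auto simp: is_graph_def carr_def)
  have disj: "verts H \<inter> edges H = {}" using H by (simp add: is_graph_def)
  have S': "equiv (carr H) S"
    "S \<subseteq> verts H \<times> verts H \<union> {(a, b) \<in> edges H \<times> edges H.
       (src H a, src H b) \<in> S \<and> (tgt H a, tgt H b) \<in> S \<and> (bar H a, bar H b) \<in> S}"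
    "\<forall>e\<in>edges H. (e, bar H e) \<notin> S"
    using S unfolding compatible_iff[OF H] by auto
  have "equiv (carr G) (S \<inter> carr G \<times> carr G)"
    using S'(1) le unfolding equiv_def refl_on_def sym_def trans_def carr_def by blast
  moreover have "p \<in> verts G \<times> verts G \<union> {(a, b) \<in> edges G \<times> edges G.
       (src G a, src G b) \<in> S \<inter> carr G \<times> carr G \<and> (tgt G a, tgt G b) \<in> S \<inter> carr G \<times> carr G \<and>
       (bar G a, bar G b) \<in> S \<inter> carr G \<times> carr G}" if p: "p \<in> S \<inter> carr G \<times> carr G" for p
  proof -
    obtain a b where ab: "p = (a, b)" "(a, b) \<in> S" "a \<in> carr G" "b \<in> carr G" using p by blast
    then consider "a \<in> verts H" "b \<in> verts H" | "a \<in> edges H" "b \<in> edges H"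
      "(src H a, src H b) \<in> S" "(tgt H a, tgt H b) \<in> S" "(bar H a, bar H b) \<in> S"
      using S'(2) by blast
    then show ?thesis
    proof cases
      case 1
      then have "a \<in> verts G" "b \<in> verts G" using ab le disj by (auto simp: carr_def)
      then show ?thesis using ab(1) by simp
    next
      case 2
      then have "a \<in> edges G" "b \<in> edges G" using ab le disj by (auto simp: carr_def)
      then show ?thesis using ab(1) 2 ops closed by simp
    qed
  qed
  moreover have "\<forall>e\<in>edges G. (e, bar G e) \<notin> S \<inter> carr G \<times> carr G"
    using S'(3) le ops by fastforce
  ultimately show ?thesis unfolding compatible_iff[OF G] by blast
qed

lemma closedin_prod_preimage:
  assumes A: "closedin T A" and B: "B \<subseteq> topspace T"
    and f: "continuous_map (subtopology T A) (subtopology T B) f"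
    and C: "closedin (prod_topology T T) C"
  shows "closedin (prod_topology T T) {(a, b) \<in> A \<times> A. (f a, f b) \<in> C}"
proof -
  let ?S = "prod_topology (subtopology T A) (subtopology T A)"
  have f': "continuous_map (subtopology T A) T f"
    using f by (simp add: continuous_map_in_subtopology)
  have "continuous_map ?S T (\<lambda>p. f (fst p))" "continuous_map ?S T (\<lambda>p. f (snd p))"
    using continuous_map_compose[OF continuous_map_fst f']
      continuous_map_compose[OF continuous_map_snd f'] by (auto simp: comp_def)
  then have "continuous_map ?S (prod_topology T T) (\<lambda>p. (f (fst p), f (snd p)))"
    by (rule continuous_map_pairedI)
  then have "closedin ?S {p \<in> topspace ?S. (f (fst p), f (snd p)) \<in> C}"
    using C by (rule closedin_continuous_map_preimage)
  moreover have "{p \<in> topspace ?S. (f (fst p), f (snd p)) \<in> C} = {(a, b) \<in> A \<times> A. (f a, f b) \<in> C}"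
    using closedin_subset[OF A] by auto
  moreover have "?S = subtopology (prod_topology T T) (A \<times> A)"
    by (simp add: subtopology_Times)
  moreover have "closedin (prod_topology T T) (A \<times> A)"
    using A by (simp add: closedin_prod_Times_iff)
  ultimately show ?thesis
    by (simp add: closedin_trans_full)
qed

text \<open>
  The incidence conditions hold on the closure because the set of pairs that satisfy them, with
  the closure itself as the target relation, is closed and contains \<open>R\<close>.
\<close>

lemma closure_compatible:
  assumes sub: "subgraph G H" and top: "topological_graph H (unif_topology (carr H) F)"
    and u: "uniformity_on (carr H) F"
    and dense: "unif_topology (carr H) F closure_of carr G = carr H"
    and R: "entourage (carr G) (induced_uniformity F (carr G)) R" and comp: "compatible G R"
  shows "compatible H
    (prod_topology (unif_topology (carr H) F) (unif_topology (carr H) F) closure_of R)"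
    (is "compatible H ?cl")
proof -
  let ?T = "unif_topology (carr H) F"
  let ?TT = "prod_topology ?T ?T"
  have G: "is_graph G" and H: "is_graph H" using sub by (auto simp: subgraph_def)
  have le: "verts G \<subseteq> verts H" "edges G \<subseteq> edges H" "carr G \<subseteq> carr H"
    and ops: "\<And>e. e \<in> edges G \<Longrightarrow> src H e = src G e \<and> tgt H e = tgt G e \<and> bar H e = bar G e"
    using sub by (auto simp: subgraph_def carr_def)
  have eqR: "equiv (carr G) R"
    and Rsub: "R \<subseteq> verts G \<times> verts G \<union> {(a, b) \<in> edges G \<times> edges G.
       (src G a, src G b) \<in> R \<and> (tgt G a, tgt G b) \<in> R \<and> (bar G a, bar G b) \<in> R}"
    and bar: "\<forall>e\<in>edges G. (e, bar G e) \<notin> R"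
    using comp unfolding compatible_iff[OF G] by auto
  have trace: "?cl \<inter> carr G \<times> carr G = R" using closure_trace[OF u le(3) R eqR] .
  have eq: "equiv (carr H) ?cl" using closure_equiv[OF u dense R eqR] .
  have V: "closedin ?T (verts H)" and E: "closedin ?T (edges H)"
    and cont: "continuous_map (subtopology ?T (edges H)) (subtopology ?T (verts H)) (src H)"
      "continuous_map (subtopology ?T (edges H)) (subtopology ?T (verts H)) (tgt H)"
      "continuous_map (subtopology ?T (edges H)) (subtopology ?T (edges H)) (bar H)"
    using top by (auto simp: topological_graph_def)
  let ?pre = "\<lambda>f. {(a, b) \<in> edges H \<times> edges H. (f a, f b) \<in> ?cl}"
  let ?C = "verts H \<times> verts H \<union> (?pre (src H) \<inter> ?pre (tgt H) \<inter> ?pre (bar H))"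
  have "closedin ?TT (?pre (src H))" "closedin ?TT (?pre (tgt H))" "closedin ?TT (?pre (bar H))"
    using closedin_prod_preimage[OF E _ _ closedin_closure_of] cont
      closedin_subset[OF V] closedin_subset[OF E] by blast+
  then have "closedin ?TT ?C"
    using V by (intro closedin_Un closedin_Int) (auto simp: closedin_prod_Times_iff)
  moreover have "p \<in> ?C" if p: "p \<in> R" for p
  proof -
    have R_cl: "R \<subseteq> ?cl" using trace by blast
    obtain a b where ab: "p = (a, b)" "(a, b) \<in> R" using p by (cases p) auto
    then consider "a \<in> verts G" "b \<in> verts G" | "a \<in> edges G" "b \<in> edges G"
      "(src G a, src G b) \<in> R" "(tgt G a, tgt G b) \<in> R" "(bar G a, bar G b) \<in> R"
      using Rsub by blast
    then show ?thesis
    proof cases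
      case 1
      then have "a \<in> verts H" "b \<in> verts H" using le(1) by blast+
      then show ?thesis using ab(1) by blast
    next
      case 2
      then have "a \<in> edges H" "b \<in> edges H"
        "(src H a, src H b) \<in> ?cl" "(tgt H a, tgt H b) \<in> ?cl" "(bar H a, bar H b) \<in> ?cl"
        using le(2) R_cl ops by auto
      then show ?thesis using ab(1) by blast
    qed
  qed
  ultimately have cl_sub: "?cl \<subseteq> ?C" by (intro closure_of_minimal) auto
  have disj: "verts H \<inter> edges H = {}" using H by (simp add: is_graph_def)
  have "(e, bar H e) \<notin> ?cl" if e: "e \<in> edges H" for e
  proof
    assume ebar: "(e, bar H e) \<in> ?cl"
    \<comment> \<open>Replace \<open>e\<close> by an edge \<open>x\<close> of \<open>G\<close> in its class; then \<open>x\<close> is related to its inverse as well.\<close>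
    have "eventually (\<lambda>p. p \<in> ?cl) F"
      using closure_is_entourage[OF u dense R] by (simp add: entourage_def)
    moreover have "e \<in> carr H" using e by (simp add: carr_def)
    ultimately obtain x where x: "x \<in> carr G" "(e, x) \<in> ?cl"
      using dense_approx[OF u dense] by blast
    then have xH: "x \<in> edges H" and bars: "(bar H e, bar H x) \<in> ?cl" using cl_sub e disj by auto
    then have xG: "x \<in> edges G" using x(1) le disj by (auto simp: carr_def)
    have "(x, bar H x) \<in> ?cl" using x(2) ebar bars eq by (meson equiv_def symD transD)
    moreover have "bar H x = bar G x" "bar G x \<in> carr G"
      using xG ops G by (auto simp: is_graph_def carr_def)
    ultimately have "(x, bar G x) \<in> R" using trace x(1) by auto
    then show False using bar xG by blast
  qed
  moreover have "?cl \<subseteq> verts H \<times> verts H \<union> {(a, b) \<in> edges H \<times> edges H.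
       (src H a, src H b) \<in> ?cl \<and> (tgt H a, tgt H b) \<in> ?cl \<and> (bar H a, bar H b) \<in> ?cl}"
    using cl_sub by blast
  ultimately show ?thesis unfolding compatible_iff[OF H] using eq by blast
qed

section \<open>The completion\<close>

theorem theorem7p7:
  fixes G H :: "'a graph"
    and F F' :: "('a \<times> 'a) filter"
    and T :: "'a topology"
    and I :: "('a \<times> 'a) set set"
  assumes "cofinite_graph G F"
    and "I = compatible_cofinite_entourages G F"
    and "is_completion G F H T F'"
  shows "cofinite_graph H F' \<and>
    {prod_topology T T closure_of R | R. R \<in> I} = compatible_cofinite_entourages H F' \<and>
    filter_base_of {prod_topology T T closure_of R | R. R \<in> I} F'"
proof -
  let ?X = "carr G" and ?Y = "carr H"
  have T: "T = unif_topology ?Y F'" and u: "uniformity_on ?Y F'"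
    and top: "topological_graph H (unif_topology ?Y F')" and haus: "Hausdorff_space T"
    and sub: "subgraph G H" and dense: "unif_topology ?Y F' closure_of ?X = ?Y"
    and F: "F = induced_uniformity F' ?X"
    using assms(3) by (auto simp: is_completion_def)
  have uG: "uniformity_on ?X F"
    and small: "\<And>S. entourage ?X F S \<Longrightarrow> \<exists>R\<in>I. R \<subseteq> S"
    using assms(1,2) by (auto simp: cofinite_graph_def)
  have XY: "?X \<subseteq> ?Y" and H: "is_graph H" using sub by (auto simp: subgraph_def carr_def)
  let ?cl = "\<lambda>R. prod_topology T T closure_of R"
  let ?B = "{?cl R | R. R \<in> I}"
  have closures: "?cl R \<in> compatible_cofinite_entourages H F'" if "R \<in> I" for R
  proof -
    have comp: "compatible G R" and ent: "entourage ?X (induced_uniformity F' ?X) R"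
      and eq: "equiv ?X R" and fin: "finite (?X // R)"
      using that assms(2) cofinite_entourage_iff[OF uG]
      by (auto simp: compatible_cofinite_entourages_def F)
    show ?thesis
      unfolding compatible_cofinite_entourages_def T
      using closure_compatible[OF sub top u dense ent comp] closure_is_entourage[OF u dense ent]
        closure_equiv[OF u dense ent eq] closure_finite_quotient[OF u XY dense ent eq fin]
      by (simp add: cofinite_entourage_iff[OF u])
  qed
  have traces: "S \<inter> ?X \<times> ?X \<in> I \<and> S = ?cl (S \<inter> ?X \<times> ?X)"
    if "S \<in> compatible_cofinite_entourages H F'" for S
  proof -
    let ?R = "S \<inter> ?X \<times> ?X"
    have comp: "compatible H S" and ent: "entourage ?Y F' S"
      and eq: "equiv ?Y S" and fin: "finite (?Y // S)"
      using that cofinite_entourage_iff[OF u] by (auto simp: compatible_cofinite_entourages_def)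
    have compR: "compatible G ?R" using trace_compatible[OF sub comp] .
    have "entourage ?X F ?R"
      using ent by (auto simp: entourage_def F eventually_induced_uniformity elim: eventually_mono)
    moreover have "equiv ?X ?R" using compR by (simp add: compatible_def)
    moreover have "finite (?X // ?R)"
    proof (rule finite_subset)
      show "?X // ?R \<subseteq> (\<lambda>C. C \<inter> ?X) ` (?Y // S)"
        using XY by (auto simp: quotient_def image_iff)
      show "finite ((\<lambda>C. C \<inter> ?X) ` (?Y // S))" using fin by simp
    qed
    ultimately have "?R \<in> I"
      using compR assms(2) by (simp add: compatible_cofinite_entourages_def cofinite_entourage_iff[OF uG])
    then show ?thesis using closure_of_trace[OF u dense ent eq] by (simp add: T)
  qed
  have B: "?B = compatible_cofinite_entourages H F'"
    using closures traces by blast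
  have base: "\<exists>Q\<in>?B. \<forall>p\<in>Q. P p" if P: "eventually P F'" for P
  proof -
    obtain D where D: "eventually D F'" "\<And>R. (\<And>p. p \<in> R \<Longrightarrow> D p) \<Longrightarrow> \<forall>p\<in>?cl R. P p"
      using small_closure[OF u P] unfolding T by blast
    have "entourage ?X F {p \<in> ?X \<times> ?X. D p}"
      using D(1) by (auto simp: entourage_def F eventually_induced_uniformity elim: eventually_mono)
    then obtain R where "R \<in> I" "R \<subseteq> {p \<in> ?X \<times> ?X. D p}" using small by blast
    then show ?thesis using D(2)[of R] by blast
  qed
  have ev: "eventually (\<lambda>p. p \<in> Q) F'" if "Q \<in> ?B" for Q
    using that unfolding B
    by (simp add: compatible_cofinite_entourages_def cofinite_entourage_def entourage_def)
  have "cofinite_graph H F'"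
    unfolding cofinite_graph_def
  proof (intro conjI allI impI)
    fix S assume "entourage ?Y F' S"
    then have "eventually (\<lambda>p. p \<in> S) F'" by (simp add: entourage_def)
    from base[OF this] show "\<exists>R\<in>compatible_cofinite_entourages H F'. R \<subseteq> S"
      unfolding B by blast
  qed (use H u haus T in auto)
  moreover have "filter_base_of ?B F'"
    unfolding filter_base_of_def
  proof (intro conjI ballI allI)
    show "?B \<noteq> {}" using base[of "\<lambda>_. True"] by auto
    fix R S assume "R \<in> ?B" "S \<in> ?B"
    then have "eventually (\<lambda>p. p \<in> R \<and> p \<in> S) F'" using ev by (simp add: eventually_conj)
    from base[OF this] show "\<exists>Q\<in>?B. Q \<subseteq> R \<inter> S" by blast
  next
    fix P
    show "eventually P F' \<longleftrightarrow> (\<exists>R\<in>?B. \<forall>p\<in>R. P p)"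
      using base ev by (metis (no_types, lifting) eventually_mono)
  qed
  ultimately show ?thesis using B by blast
qed

end
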